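(* Let $(\mathrm{FinSet}^{\mathrm{op}},T,p,+,0,\ell,c)$ be a Cartesian tangent structure on the opposite $\mathrm{FinSet}^{\mathrm{op}}$ of the category of finite sets and functions. Then it is in fact the trivial tangent structure, i.e. $T=1_{\mathrm{FinSet}^{\mathrm{op}}}$ and $p=+=0=\ell=c=1$.
   Context: Additive bundles. An additive bundle $(X,A,p,+,0)$ over an object $A$ of a category is a morphism $p:X\to A$ all of whose finite pullback powers $X_n$ (the $n$-fold fibre product of $X$ with itself over $A$) exist, together with morphisms $+:X_2\to X$ and $0:A\to X$ such that $p\circ + = p\circ\pi_0=p\circ\pi_1$, $p\circ 0=1_A$, and $+$ is associative, commutative and unital with unit $0$ (i.e. $+\circ\langle 0\circ p,1_X\rangle=1_X$). An additive bundle morphism $(X,A,p,+,0)\to(Y,B,p',+',0')$ is a pair $f:X\to Y$, $g:A\to B$ with $p'\circ f=g\circ p$, $f\circ + = +'\circ\langle f\pi_0,f\pi_1\rangle$ and $f\circ 0=0'\circ g$. Tangent category. A tangent category $(\mathbb X,T,p,0,+,\ell,c)$ (the data $(T,p,0,+,\ell,c)$ being a tangent structure on $\mathbb X$) consists of a category $\mathbb X$ and: a functor $T:\mathbb X\to\mathbb X$ and a natural transformation $p:T\to 1$ such that all pullback powers $T_nM$ of $p_M:TM\to M$ exist and are preserved by $T$; natural transformations $+:T_2\to T$ and $0:1\to T$ making each $(TM,M,p_M,+_M,0_M)$ an additive bundle; a natural transformation $\ell:T\to T^2$ such that $(\ell_M,0_M)$ is an additive bundle morphism from $(TM,M,p_M,+_M,0_M)$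 to $(T^2M,TM,T(p_M),T(+_M),T(0_M))$; a natural transformation $c:T^2\to T^2$ with $c\circ c=1$ and $c\circ\ell=\ell$ such that $(c_M,1)$ is an additive bundle morphism from $(T^2M,TM,T(p_M),T(+_M),T(0_M))$ to $(T^2M,TM,p_{TM},+_{TM},0_{TM})$. Moreover $T(\ell_M)\circ\ell_M=\ell_{TM}\circ\ell_M$, $c_{TM}\circ T(c_M)\circ c_{TM}=T(c_M)\circ c_{TM}\circ T(c_M)$, $c_{TM}\circ T(c_M)\circ\ell_{TM}=T(\ell_M)\circ c_M$, and (universality of the vertical lift) the commutative square with top $\nu:T_2M\to T^2M$, $\nu=T(+_M)\circ\langle\ell_M\circ\pi_0,0_{TM}\circ\pi_1\rangle$, left side $p_M\circ\pi_0:T_2M\to M$, right side $T(p_M):T^2M\to TM$ and bottom $0_M:M\to TM$ is a pullback preserved by all powers of $T$. Here $T^2=T\circ T$, while $T_2$ denotes the pullback of $p$ along itself. A tangent category (or its tangent structure) is Cartesian if $\mathbb X$ has finite products and they are compatible with the tangent structure, i.e. $T$ preserves finite products (via the canonical maps induced by applying $T$ to the projections). The trivial tangent structure on a category $\mathbb X$ has $T=1_{\mathbb X}$ and all structure transformations equal to identities. Finite products in $\mathrm{FinSet}^{\mathrm{op}}$ are disjoint unions of finite sets.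
   Formalization: "It is the trivial tangent structure" is proved up to isomorphism of tangent structures (a natural isomorphism T ⇒ 1 compatible with p, +, 0, ℓ, c), since literal T = 1 fails for transported copies; FinSet is the finite subsets of an arbitrary infinite type. *)

theory Defs
  imports "HOL-Library.FuncSet" "HOL-Library.Infinite_Typeclass"
begin

section \<open>Categories, endofunctors and natural transformations\<close>

record ('o, 'a) cat =
  Obj :: "'o set"
  Arr :: "'a set"
  Dom :: "'a \<Rightarrow> 'o"
  Cod :: "'a \<Rightarrow> 'o"
  Ident :: "'o \<Rightarrow> 'a"
  Comp :: "'a \<Rightarrow> 'a \<Rightarrow> 'a"  (infixr "\<cdot>\<index>" 70)

definition Hom :: "('o, 'a) cat \<Rightarrow> 'o \<Rightarrow> 'o \<Rightarrow> 'a set" where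
  "Hom C X Y = {f \<in> Arr C. Dom C f = X \<and> Cod C f = Y}"

locale category =
  fixes C :: "('o, 'a) cat" (structure)
  assumes Dom_Obj: "f \<in> Arr C \<Longrightarrow> Dom C f \<in> Obj C"
    and Cod_Obj: "f \<in> Arr C \<Longrightarrow> Cod C f \<in> Obj C"
    and Ident_Hom: "X \<in> Obj C \<Longrightarrow> Ident C X \<in> Hom C X X"
    and Comp_Hom: "f \<in> Hom C X Y \<Longrightarrow> g \<in> Hom C Y Z \<Longrightarrow> g \<cdot> f \<in> Hom C X Z"
    and Comp_Ident_left: "f \<in> Hom C X Y \<Longrightarrow> Ident C Y \<cdot> f = f"
    and Comp_Ident_right: "f \<in> Hom C X Y \<Longrightarrow> f \<cdot> Ident C X = f"
    and Comp_assoc: "f \<in> Hom C W X \<Longrightarrow> g \<in> Hom C X Y \<Longrightarrow> h \<in> Hom C Y Z \<Longrightarrow>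
      (h \<cdot> g) \<cdot> f = h \<cdot> (g \<cdot> f)"

definition op_cat :: "('o, 'a) cat \<Rightarrow> ('o, 'a) cat" where
  "op_cat C = \<lparr>Obj = Obj C, Arr = Arr C, Dom = Cod C, Cod = Dom C, Ident = Ident C,
     Comp = (\<lambda>g f. f \<cdot>\<^bsub>C\<^esub> g)\<rparr>"

definition is_iso :: "('o, 'a) cat \<Rightarrow> 'a \<Rightarrow> bool" where
  "is_iso C f \<longleftrightarrow> f \<in> Arr C \<and>
     (\<exists>g \<in> Hom C (Cod C f) (Dom C f).
        g \<cdot>\<^bsub>C\<^esub> f = Ident C (Dom C f) \<and> f \<cdot>\<^bsub>C\<^esub> g = Ident C (Cod C f))"

record ('o, 'a) endofun =
  onO :: "'o \<Rightarrow> 'o"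
  onA :: "'a \<Rightarrow> 'a"

definition endofunctor :: "('o, 'a) cat \<Rightarrow> ('o, 'a) endofun \<Rightarrow> bool" where
  "endofunctor C F \<longleftrightarrow>
     (\<forall>X \<in> Obj C. onO F X \<in> Obj C) \<and>
     (\<forall>X Y. \<forall>f \<in> Hom C X Y. onA F f \<in> Hom C (onO F X) (onO F Y)) \<and>
     (\<forall>X \<in> Obj C. onA F (Ident C X) = Ident C (onO F X)) \<and>
     (\<forall>X Y Z. \<forall>f \<in> Hom C X Y. \<forall>g \<in> Hom C Y Z.
        onA F (g \<cdot>\<^bsub>C\<^esub> f) = onA F g \<cdot>\<^bsub>C\<^esub> onA F f)"

definition id_fun :: "('o, 'a) endofun" where
  "id_fun = \<lparr>onO = (\<lambda>X. X), onA = (\<lambda>f. f)\<rparr>"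

definition comp_fun :: "('o, 'a) endofun \<Rightarrow> ('o, 'a) endofun \<Rightarrow> ('o, 'a) endofun" where
  "comp_fun F G = \<lparr>onO = (\<lambda>X. onO F (onO G X)), onA = (\<lambda>f. onA F (onA G f))\<rparr>"

definition pow_fun :: "('o, 'a) endofun \<Rightarrow> nat \<Rightarrow> ('o, 'a) endofun" where
  "pow_fun F k = (comp_fun F ^^ k) id_fun"

definition nat_trans ::
  "('o, 'a) cat \<Rightarrow> ('o, 'a) endofun \<Rightarrow> ('o, 'a) endofun \<Rightarrow> ('o \<Rightarrow> 'a) \<Rightarrow> bool" where
  "nat_trans C F G \<eta> \<longleftrightarrow>
     (\<forall>M \<in> Obj C. \<eta> M \<in> Hom C (onO F M) (onO G M)) \<and>
     (\<forall>M N. \<forall>f \<in> Hom C M N. onA G f \<cdot>\<^bsub>C\<^esub> \<eta> M = \<eta> N \<cdot>\<^bsub>C\<^esub> onA F f)"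


section \<open>Finite products, pullbacks and fibre powers\<close>

text \<open>Only the values of \<open>X\<close>, \<open>pr\<close>, \<open>x\<close> at indices below \<open>n\<close> matter.\<close>

definition is_product ::
  "('o, 'a) cat \<Rightarrow> nat \<Rightarrow> (nat \<Rightarrow> 'o) \<Rightarrow> 'o \<Rightarrow> (nat \<Rightarrow> 'a) \<Rightarrow> bool" where
  "is_product C n X P pr \<longleftrightarrow>
     P \<in> Obj C \<and> (\<forall>i<n. pr i \<in> Hom C P (X i)) \<and>
     (\<forall>W \<in> Obj C. \<forall>x. (\<forall>i<n. x i \<in> Hom C W (X i)) \<longrightarrow>
        (\<exists>!h. h \<in> Hom C W P \<and> (\<forall>i<n. pr i \<cdot>\<^bsub>C\<^esub> h = x i)))"

text \<open>\<open>P\<close> with \<open>a : P \<rightarrow> Dom f\<close> and \<open>b : P \<rightarrow> Dom g\<close> is a pullback of the cospan \<open>f\<close>, \<open>g\<close>.\<close>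

definition is_pullback :: "('o, 'a) cat \<Rightarrow> 'a \<Rightarrow> 'a \<Rightarrow> 'o \<Rightarrow> 'a \<Rightarrow> 'a \<Rightarrow> bool" where
  "is_pullback C f g P a b \<longleftrightarrow>
     f \<in> Arr C \<and> g \<in> Arr C \<and> Cod C f = Cod C g \<and>
     a \<in> Hom C P (Dom C f) \<and> b \<in> Hom C P (Dom C g) \<and> f \<cdot>\<^bsub>C\<^esub> a = g \<cdot>\<^bsub>C\<^esub> b \<and>
     (\<forall>W \<in> Obj C. \<forall>x \<in> Hom C W (Dom C f). \<forall>y \<in> Hom C W (Dom C g).
        f \<cdot>\<^bsub>C\<^esub> x = g \<cdot>\<^bsub>C\<^esub> y \<longrightarrow>
        (\<exists>!h. h \<in> Hom C W P \<and> a \<cdot>\<^bsub>C\<^esub> h = x \<and> b \<cdot>\<^bsub>C\<^esub> h = y))"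

text \<open>
  The \<open>n\<close>-fold fibre product of \<open>p : X \<rightarrow> A\<close> with itself over \<open>A\<close>. The cone carries its leg
  \<open>q\<close> to \<open>A\<close> explicitly, so that the case \<open>n = 0\<close> is correct (it gives \<open>A\<close> itself).
\<close>

definition is_fibre_power ::
  "('o, 'a) cat \<Rightarrow> 'a \<Rightarrow> nat \<Rightarrow> 'o \<Rightarrow> 'a \<Rightarrow> (nat \<Rightarrow> 'a) \<Rightarrow> bool" where
  "is_fibre_power C p n P q pr \<longleftrightarrow>
     p \<in> Arr C \<and> q \<in> Hom C P (Cod C p) \<and>
     (\<forall>i<n. pr i \<in> Hom C P (Dom C p) \<and> p \<cdot>\<^bsub>C\<^esub> pr i = q) \<and>
     (\<forall>W \<in> Obj C. \<forall>r \<in> Hom C W (Cod C p). \<forall>x.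
        (\<forall>i<n. x i \<in> Hom C W (Dom C p) \<and> p \<cdot>\<^bsub>C\<^esub> x i = r) \<longrightarrow>
        (\<exists>!h. h \<in> Hom C W P \<and> q \<cdot>\<^bsub>C\<^esub> h = r \<and> (\<forall>i<n. pr i \<cdot>\<^bsub>C\<^esub> h = x i)))"

text \<open>The map \<open>\<langle>x, y\<rangle>\<close> into a pullback \<open>P\<close> with projections \<open>a\<close>, \<open>b\<close>.\<close>

definition pairing :: "('o, 'a) cat \<Rightarrow> 'o \<Rightarrow> 'a \<Rightarrow> 'a \<Rightarrow> 'a \<Rightarrow> 'a \<Rightarrow> 'a" where
  "pairing C P a b x y =
     (THE h. h \<in> Hom C (Dom C x) P \<and> a \<cdot>\<^bsub>C\<^esub> h = x \<and> b \<cdot>\<^bsub>C\<^esub> h = y)"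


section \<open>Additive bundles\<close>

text \<open>The pullback \<open>X\<^sub>2\<close> with its two projections, over which addition is defined,
  is part of the data.\<close>

record ('o, 'a) add_bundle =
  tot :: 'o
  base :: 'o
  proj :: 'a
  sq :: 'o
  sq0 :: 'a
  sq1 :: 'a
  add :: 'a
  zer :: 'a

definition bpair :: "('o, 'a) cat \<Rightarrow> ('o, 'a) add_bundle \<Rightarrow> 'a \<Rightarrow> 'a \<Rightarrow> 'a" where
  "bpair C B x y = pairing C (sq B) (sq0 B) (sq1 B) x y"

locale additive_bundle =
  fixes C :: "('o, 'a) cat" (structure) and B :: "('o, 'a) add_bundle"
  assumes proj_Hom: "proj B \<in> Hom C (tot B) (base B)"
    and fibre_powers: "\<exists>P q pr. is_fibre_power C (proj B) n P q pr"
    and sq_pullback: "is_pullback C (proj B) (proj B) (sq B) (sq0 B) (sq1 B)"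
    and add_Hom: "add B \<in> Hom C (sq B) (tot B)"
    and zer_Hom: "zer B \<in> Hom C (base B) (tot B)"
    and proj_add0: "proj B \<cdot> add B = proj B \<cdot> sq0 B"
    and proj_add1: "proj B \<cdot> add B = proj B \<cdot> sq1 B"
    and proj_zer: "proj B \<cdot> zer B = Ident C (base B)"
    and add_assoc: "is_fibre_power C (proj B) 3 P q pr \<Longrightarrow>
      add B \<cdot> bpair C B (add B \<cdot> bpair C B (pr 0) (pr 1)) (pr 2) =
      add B \<cdot> bpair C B (pr 0) (add B \<cdot> bpair C B (pr 1) (pr 2))"
    and add_commute: "add B \<cdot> bpair C B (sq1 B) (sq0 B) = add B"
    and add_unit: "add B \<cdot> bpair C B (zer B \<cdot> proj B) (Ident C (tot B)) = Ident C (tot B)"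

definition bundle_morphism ::
  "('o, 'a) cat \<Rightarrow> ('o, 'a) add_bundle \<Rightarrow> ('o, 'a) add_bundle \<Rightarrow> 'a \<Rightarrow> 'a \<Rightarrow> bool" where
  "bundle_morphism C B B' f g \<longleftrightarrow>
     f \<in> Hom C (tot B) (tot B') \<and> g \<in> Hom C (base B) (base B') \<and>
     proj B' \<cdot>\<^bsub>C\<^esub> f = g \<cdot>\<^bsub>C\<^esub> proj B \<and>
     f \<cdot>\<^bsub>C\<^esub> add B = add B' \<cdot>\<^bsub>C\<^esub> bpair C B' (f \<cdot>\<^bsub>C\<^esub> sq0 B) (f \<cdot>\<^bsub>C\<^esub> sq1 B) \<and>
     f \<cdot>\<^bsub>C\<^esub> zer B = zer B' \<cdot>\<^bsub>C\<^esub> g"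

definition map_bundle :: "('o, 'a) endofun \<Rightarrow> ('o, 'a) add_bundle \<Rightarrow> ('o, 'a) add_bundle" where
  "map_bundle F B = \<lparr>tot = onO F (tot B), base = onO F (base B), proj = onA F (proj B),
     sq = onO F (sq B), sq0 = onA F (sq0 B), sq1 = onA F (sq1 B),
     add = onA F (add B), zer = onA F (zer B)\<rparr>"


section \<open>Tangent categories\<close>

text \<open>
  \<open>tT2 M\<close>, \<open>tpi0 M\<close>, \<open>tpi1 M\<close> are the pullback \<open>T\<^sub>2M\<close> of \<open>p\<^sub>M\<close> along itself with its projections,
  on which the addition \<open>tplus M : T\<^sub>2M \<rightarrow> TM\<close> is defined; any choice of these pullbacks is allowed.
\<close>

record ('o, 'a) tangent =
  tT :: "('o, 'a) endofun"
  tT2 :: "'o \<Rightarrow> 'o"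
  tpi0 :: "'o \<Rightarrow> 'a"
  tpi1 :: "'o \<Rightarrow> 'a"
  tp :: "'o \<Rightarrow> 'a"
  tzero :: "'o \<Rightarrow> 'a"
  tplus :: "'o \<Rightarrow> 'a"
  tlift :: "'o \<Rightarrow> 'a"
  tflip :: "'o \<Rightarrow> 'a"

abbreviation TO :: "('o, 'a) tangent \<Rightarrow> 'o \<Rightarrow> 'o" where "TO S \<equiv> onO (tT S)"
abbreviation TA :: "('o, 'a) tangent \<Rightarrow> 'a \<Rightarrow> 'a" where "TA S \<equiv> onA (tT S)"

definition tbundle :: "('o, 'a) tangent \<Rightarrow> 'o \<Rightarrow> ('o, 'a) add_bundle" where
  "tbundle S M = \<lparr>tot = TO S M, base = M, proj = tp S M,
     sq = tT2 S M, sq0 = tpi0 S M, sq1 = tpi1 S M, add = tplus S M, zer = tzero S M\<rparr>"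

text \<open>\<open>T\<^sub>2\<close> as an endofunctor: \<open>T\<^sub>2f = \<langle>T f \<circ> \<pi>\<^sub>0, T f \<circ> \<pi>\<^sub>1\<rangle>\<close>.\<close>

definition T2_fun :: "('o, 'a) cat \<Rightarrow> ('o, 'a) tangent \<Rightarrow> ('o, 'a) endofun" where
  "T2_fun C S = \<lparr>onO = tT2 S, onA = (\<lambda>f. bpair C (tbundle S (Cod C f))
     (TA S f \<cdot>\<^bsub>C\<^esub> tpi0 S (Dom C f)) (TA S f \<cdot>\<^bsub>C\<^esub> tpi1 S (Dom C f)))\<rparr>"

text \<open>The pairing below is into \<open>T(T\<^sub>2M)\<close>, the pullback of \<open>T(p\<^sub>M)\<close> along itself.\<close>

definition tnu :: "('o, 'a) cat \<Rightarrow> ('o, 'a) tangent \<Rightarrow> 'o \<Rightarrow> 'a" where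
  "tnu C S M = TA S (tplus S M) \<cdot>\<^bsub>C\<^esub> bpair C (map_bundle (tT S) (tbundle S M))
     (tlift S M \<cdot>\<^bsub>C\<^esub> tpi0 S M) (tzero S (TO S M) \<cdot>\<^bsub>C\<^esub> tpi1 S M)"

locale tangent_category = category C
  for C :: "('o, 'a) cat" (structure) and S :: "('o, 'a) tangent" +
  assumes T_functor: "endofunctor C (tT S)"
    and p_natural: "nat_trans C (tT S) id_fun (tp S)"
    and Tn_exist: "M \<in> Obj C \<Longrightarrow> \<exists>P q pr. is_fibre_power C (tp S M) n P q pr"
    and Tn_preserved: "M \<in> Obj C \<Longrightarrow> is_fibre_power C (tp S M) n P q pr \<Longrightarrow>
      is_fibre_power C (TA S (tp S M)) n (TO S P) (TA S q) (\<lambda>i. TA S (pr i))"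
    and T2_pullback: "M \<in> Obj C \<Longrightarrow>
      is_pullback C (tp S M) (tp S M) (tT2 S M) (tpi0 S M) (tpi1 S M)"
    and plus_natural: "nat_trans C (T2_fun C S) (tT S) (tplus S)"
    and zero_natural: "nat_trans C id_fun (tT S) (tzero S)"
    and T_bundle: "M \<in> Obj C \<Longrightarrow> additive_bundle C (tbundle S M)"
    and lift_natural: "nat_trans C (tT S) (comp_fun (tT S) (tT S)) (tlift S)"
    and lift_bundle: "M \<in> Obj C \<Longrightarrow>
      bundle_morphism C (tbundle S M) (map_bundle (tT S) (tbundle S M)) (tlift S M) (tzero S M)"
    and flip_natural: "nat_trans C (comp_fun (tT S) (tT S)) (comp_fun (tT S) (tT S)) (tflip S)"
    and flip_flip: "M \<in> Obj C \<Longrightarrow> tflip S M \<cdot> tflip S M = Ident C (TO S (TO S M))"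
    and flip_lift: "M \<in> Obj C \<Longrightarrow> tflip S M \<cdot> tlift S M = tlift S M"
    and flip_bundle: "M \<in> Obj C \<Longrightarrow>
      bundle_morphism C (map_bundle (tT S) (tbundle S M)) (tbundle S (TO S M))
        (tflip S M) (Ident C (TO S M))"
    and lift_lift: "M \<in> Obj C \<Longrightarrow>
      TA S (tlift S M) \<cdot> tlift S M = tlift S (TO S M) \<cdot> tlift S M"
    and flip_braid: "M \<in> Obj C \<Longrightarrow>
      tflip S (TO S M) \<cdot> TA S (tflip S M) \<cdot> tflip S (TO S M) =
      TA S (tflip S M) \<cdot> tflip S (TO S M) \<cdot> TA S (tflip S M)"
    and flip_lift_braid: "M \<in> Obj C \<Longrightarrow>
      tflip S (TO S M) \<cdot> TA S (tflip S M) \<cdot> tlift S (TO S M) =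
      TA S (tlift S M) \<cdot> tflip S M"
    and lift_universal: "M \<in> Obj C \<Longrightarrow>
      is_pullback C (onA (pow_fun (tT S) k) (tzero S M))
        (onA (pow_fun (tT S) k) (TA S (tp S M)))
        (onO (pow_fun (tT S) k) (tT2 S M))
        (onA (pow_fun (tT S) k) (tp S M \<cdot> tpi0 S M))
        (onA (pow_fun (tT S) k) (tnu C S M))"

locale cartesian_tangent_category = tangent_category C S
  for C :: "('o, 'a) cat" (structure) and S :: "('o, 'a) tangent" +
  assumes products_exist: "(\<And>i. i < n \<Longrightarrow> X i \<in> Obj C) \<Longrightarrow> \<exists>P pr. is_product C n X P pr"
    and products_preserved: "is_product C n X P pr \<Longrightarrow> (\<And>i. i < n \<Longrightarrow> X i \<in> Obj C) \<Longrightarrow>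
      is_product C n (\<lambda>i. TO S (X i)) (TO S P) (\<lambda>i. TA S (pr i))"

text \<open>For \<open>p = 1\<close> the pullback \<open>T\<^sub>2M\<close> is taken to be \<open>M\<close> with identity projections.\<close>

definition trivial_tangent :: "('o, 'a) cat \<Rightarrow> ('o, 'a) tangent" where
  "trivial_tangent C = \<lparr>tT = id_fun, tT2 = (\<lambda>M. M), tpi0 = Ident C, tpi1 = Ident C,
     tp = Ident C, tzero = Ident C, tplus = Ident C, tlift = Ident C, tflip = Ident C\<rparr>"

text \<open>
  A natural isomorphism \<open>\<phi> : T \<rightarrow> T'\<close> identifying the tangent structures \<open>S\<close> and \<open>S'\<close> on \<open>C\<close>.
  The induced maps are \<open>\<phi>\<^sub>2 = \<langle>\<phi> \<circ> \<pi>\<^sub>0, \<phi> \<circ> \<pi>\<^sub>1\<rangle> : T\<^sub>2M \<rightarrow> T'\<^sub>2M\<close> and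
  \<open>T'(\<phi>\<^sub>M) \<circ> \<phi>\<^sub>T\<^sub>M : T\<^sup>2M \<rightarrow> T'\<^sup>2M\<close>.
\<close>

definition tangent_iso ::
  "('o, 'a) cat \<Rightarrow> ('o, 'a) tangent \<Rightarrow> ('o, 'a) tangent \<Rightarrow> ('o \<Rightarrow> 'a) \<Rightarrow> bool" where
  "tangent_iso C S S' \<phi> \<longleftrightarrow>
     nat_trans C (tT S) (tT S') \<phi> \<and>
     (\<forall>M \<in> Obj C.
        is_iso C (\<phi> M) \<and>
        tp S' M \<cdot>\<^bsub>C\<^esub> \<phi> M = tp S M \<and>
        \<phi> M \<cdot>\<^bsub>C\<^esub> tzero S M = tzero S' M \<and>
        \<phi> M \<cdot>\<^bsub>C\<^esub> tplus S M =
          tplus S' M \<cdot>\<^bsub>C\<^esub>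
            bpair C (tbundle S' M) (\<phi> M \<cdot>\<^bsub>C\<^esub> tpi0 S M) (\<phi> M \<cdot>\<^bsub>C\<^esub> tpi1 S M) \<and>
        (TA S' (\<phi> M) \<cdot>\<^bsub>C\<^esub> \<phi> (TO S M)) \<cdot>\<^bsub>C\<^esub> tlift S M = tlift S' M \<cdot>\<^bsub>C\<^esub> \<phi> M \<and>
        (TA S' (\<phi> M) \<cdot>\<^bsub>C\<^esub> \<phi> (TO S M)) \<cdot>\<^bsub>C\<^esub> tflip S M =
          tflip S' M \<cdot>\<^bsub>C\<^esub> (TA S' (\<phi> M) \<cdot>\<^bsub>C\<^esub> \<phi> (TO S M)))"


section \<open>Finite sets\<close>

text \<open>
  The finite subsets of an arbitrary infinite type \<open>'u\<close>, with all functions between them;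
  \<open>(A, f, B)\<close> is the function \<open>f : A \<rightarrow> B\<close>, where \<open>f\<close> is \<open>undefined\<close> outside \<open>A\<close>. Since \<open>'u\<close> is
  infinite, every finite set is in bijection with an object, and disjoint unions exist up to bijection.
\<close>

definition FinSet :: "('u::infinite set, 'u set \<times> ('u \<Rightarrow> 'u) \<times> 'u set) cat" where
  "FinSet = \<lparr>Obj = {A. finite A},
     Arr = {(A, f, B). finite A \<and> finite B \<and> f \<in> A \<rightarrow>\<^sub>E B},
     Dom = (\<lambda>(A, f, B). A), Cod = (\<lambda>(A, f, B). B),
     Ident = (\<lambda>A. (A, restrict (\<lambda>x. x) A, A)),
     Comp = (\<lambda>(_, g, D) (A, f, _). (A, compose A g f, D))\<rparr>"

end

theory Submission
  imports Defs
begin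

text \<open>
  In \<open>FinSet\<close>, the bundle \<open>p\<^sub>M\<close> is a function \<open>M \<rightarrow> TM\<close> with retraction \<open>0\<^sub>M\<close>, and \<open>T\<^sub>2M\<close> is the
  pushout of two copies of \<open>TM\<close> glued along \<open>M\<close>. The addition \<open>TM \<rightarrow> T\<^sub>2M\<close> sends \<open>x\<close> into one of the
  two copies; the unit law that collapses this copy onto \<open>M\<close> then shows that \<open>x\<close> lies in the image
  of \<open>p\<^sub>M\<close>. Hence \<open>p\<close> is invertible, and a tangent structure with invertible \<open>p\<close> is identified
  with the trivial one by \<open>p\<close> itself.
\<close>

lemma is_pullback_pairing:
  assumes "is_pullback C f g P a b" "W \<in> Obj C" "x \<in> Hom C W (Dom C f)" "y \<in> Hom C W (Dom C g)"
    and "f \<cdot>\<^bsub>C\<^esub> x = g \<cdot>\<^bsub>C\<^esub> y"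
  shows "pairing C P a b x y \<in> Hom C W P \<and>
    a \<cdot>\<^bsub>C\<^esub> pairing C P a b x y = x \<and> b \<cdot>\<^bsub>C\<^esub> pairing C P a b x y = y"
proof -
  have "\<exists>!h. h \<in> Hom C W P \<and> a \<cdot>\<^bsub>C\<^esub> h = x \<and> b \<cdot>\<^bsub>C\<^esub> h = y"
    using assms unfolding is_pullback_def by blast
  moreover have "Dom C x = W"
    using assms(3) by (simp add: Hom_def)
  ultimately show ?thesis
    unfolding pairing_def by (simp only:) (rule theI')
qed

text \<open>The axioms contain only the left unit law, witnessed by \<open>h\<close>, the pairing of
  \<open>zer B\<close> after \<open>proj B\<close> with the identity. Following \<open>h\<close> by
  the swap of the two factors gives \<open>k\<close>, and \<open>add_commute\<close> turns the left
  law into the right one.\<close>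

lemma additive_bundle_units:
  assumes "category C" "additive_bundle C B"
  obtains h k where
    "h \<in> Hom C (tot B) (sq B)" "sq0 B \<cdot>\<^bsub>C\<^esub> h = zer B \<cdot>\<^bsub>C\<^esub> proj B"
    "sq1 B \<cdot>\<^bsub>C\<^esub> h = Ident C (tot B)" "add B \<cdot>\<^bsub>C\<^esub> h = Ident C (tot B)"
    "k \<in> Hom C (tot B) (sq B)" "sq0 B \<cdot>\<^bsub>C\<^esub> k = Ident C (tot B)"
    "sq1 B \<cdot>\<^bsub>C\<^esub> k = zer B \<cdot>\<^bsub>C\<^esub> proj B" "add B \<cdot>\<^bsub>C\<^esub> k = Ident C (tot B)"
proof -
  interpret category C by fact
  interpret B: additive_bundle C B by fact
  have X: "tot B \<in> Obj C" and P: "sq B \<in> Obj C"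
    using B.proj_Hom B.add_Hom Dom_Obj[of "proj B"] Dom_Obj[of "add B"] by (auto simp: Hom_def)
  have D: "Dom C (proj B) = tot B"
    using B.proj_Hom by (simp add: Hom_def)
  have a: "sq0 B \<in> Hom C (sq B) (tot B)" and b: "sq1 B \<in> Hom C (sq B) (tot B)"
    and ab: "proj B \<cdot>\<^bsub>C\<^esub> sq0 B = proj B \<cdot>\<^bsub>C\<^esub> sq1 B"
    using B.sq_pullback D by (simp_all add: is_pullback_def)
  have zp: "zer B \<cdot>\<^bsub>C\<^esub> proj B \<in> Hom C (tot B) (tot B)"
    using B.proj_Hom B.zer_Hom Comp_Hom by blast
  \<comment> \<open>The pairing \<open>h\<close> exists because its two components agree over the
    base.\<close>
  have "proj B \<cdot>\<^bsub>C\<^esub> (zer B \<cdot>\<^bsub>C\<^esub> proj B) = proj B \<cdot>\<^bsub>C\<^esub> Ident C (tot B)"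
    using Comp_assoc[OF B.proj_Hom B.zer_Hom B.proj_Hom] B.proj_zer
      Comp_Ident_left[OF B.proj_Hom] Comp_Ident_right[OF B.proj_Hom] by simp
  note h = is_pullback_pairing[OF B.sq_pullback X, unfolded D, OF zp Ident_Hom[OF X] this,
      folded bpair_def]
  note s = is_pullback_pairing[OF B.sq_pullback P, unfolded D, OF b a ab[symmetric],
      folded bpair_def]
  let ?h = "bpair C B (zer B \<cdot>\<^bsub>C\<^esub> proj B) (Ident C (tot B))"
  let ?s = "bpair C B (sq1 B) (sq0 B)"
  have hH: "?h \<in> Hom C (tot B) (sq B)" and sH: "?s \<in> Hom C (sq B) (sq B)"
    using h s by auto
  show thesis
  proof (rule that[of ?h "?s \<cdot>\<^bsub>C\<^esub> ?h"])
    show "?s \<cdot>\<^bsub>C\<^esub> ?h \<in> Hom C (tot B) (sq B)"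
      using hH sH by (rule Comp_Hom)
    show "sq0 B \<cdot>\<^bsub>C\<^esub> ?s \<cdot>\<^bsub>C\<^esub> ?h = Ident C (tot B)"
      "sq1 B \<cdot>\<^bsub>C\<^esub> ?s \<cdot>\<^bsub>C\<^esub> ?h = zer B \<cdot>\<^bsub>C\<^esub> proj B"
      "add B \<cdot>\<^bsub>C\<^esub> ?s \<cdot>\<^bsub>C\<^esub> ?h = Ident C (tot B)"
      using Comp_assoc[OF hH sH a] Comp_assoc[OF hH sH b] Comp_assoc[OF hH sH B.add_Hom]
        h s B.add_commute B.add_unit by simp_all
  qed (use h B.add_unit in auto)
qed

text \<open>The underlying function of an arrow runs backwards in \<open>op_cat FinSet\<close>: its
  domain, \<open>fst f\<close>, is the codomain of the arrow. Composites therefore apply the left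
  factor first.\<close>

definition app :: "'u set \<times> ('u \<Rightarrow> 'u) \<times> 'u set \<Rightarrow> 'u \<Rightarrow> 'u" where
  "app f = fst (snd f)"

lemma Hom_op_FinSet:
  "f \<in> Hom (op_cat FinSet) X Y \<longleftrightarrow>
     fst f = Y \<and> snd (snd f) = X \<and> finite X \<and> finite Y \<and> app f \<in> Y \<rightarrow>\<^sub>E X"
  by (cases f) (auto simp: Hom_def op_cat_def FinSet_def app_def)

lemma Obj_op_FinSet: "X \<in> Obj (op_cat FinSet) \<longleftrightarrow> finite X"
  by (simp add: op_cat_def FinSet_def)

lemma Comp_op_FinSet: "g \<cdot>\<^bsub>op_cat FinSet\<^esub> f = (fst g, compose (fst g) (app f) (app g), snd (snd f))"
  by (cases f, cases g) (simp add: op_cat_def FinSet_def app_def)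

lemma app_Comp_op_FinSet: "x \<in> fst g \<Longrightarrow> app (g \<cdot>\<^bsub>op_cat FinSet\<^esub> f) x = app f (app g x)"
  by (simp add: Comp_op_FinSet app_def compose_def)

lemma app_Ident_op_FinSet: "x \<in> X \<Longrightarrow> app (Ident (op_cat FinSet) X) x = x"
  by (simp add: op_cat_def FinSet_def app_def)

lemma op_FinSet_arr_eqI:
  assumes "f \<in> Hom (op_cat FinSet) X Y" "g \<in> Hom (op_cat FinSet) X Y"
    and "\<And>y. y \<in> Y \<Longrightarrow> app f y = app g y"
  shows "f = g"
proof -
  have "app f = app g"
    using assms by (auto simp: Hom_op_FinSet intro: PiE_ext)
  then show ?thesis
    using assms(1,2) by (auto simp: Hom_op_FinSet app_def prod_eq_iff)
qed

text \<open>Otherwise the map to a two-element set that detects the union of the images would compete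
  with a constant map in the universal property.\<close>

lemma pushout_legs_jointly_surj:
  fixes f :: "'u::infinite set \<times> ('u \<Rightarrow> 'u) \<times> 'u set"
  assumes "category (op_cat (FinSet :: ('u set, _) cat))"
    and pb: "is_pullback (op_cat FinSet) f g P a b"
  shows "P \<subseteq> app a ` fst a \<union> app b ` fst b"
proof
  fix x assume "x \<in> P"
  interpret category "op_cat (FinSet :: ('u set, _) cat)" by fact
  let ?C = "op_cat (FinSet :: ('u set, _) cat)"
  let ?I = "app a ` fst a \<union> app b ` fst b"
  have a: "a \<in> Hom ?C P (Dom ?C f)" and b: "b \<in> Hom ?C P (Dom ?C g)"
    and f: "f \<in> Hom ?C (Dom ?C f) (Cod ?C f)" and g: "g \<in> Hom ?C (Dom ?C g) (Cod ?C f)"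
    and fg: "f \<cdot>\<^bsub>?C\<^esub> a = g \<cdot>\<^bsub>?C\<^esub> b"
    using pb by (auto simp: is_pullback_def Hom_def)
  have P: "finite P"
    using a by (simp add: Hom_op_FinSet)
  \<comment> \<open>The point \<open>x\<close> itself serves as one of the two values;
    \<open>'u\<close> is infinite, so a second one exists.\<close>
  obtain v :: 'u where "v \<noteq> x"
    by (metis finite.simps insertCI ex_new_if_finite infinite_UNIV)
  \<comment> \<open>As functions out of \<open>P\<close>, \<open>c\<close> is constantly
    \<open>x\<close>, and \<open>d\<close> takes the value \<open>v\<close> exactly off the two
    images. Both restrict to the constant \<open>x\<close> along each leg.\<close>
  define c where "c = (P, restrict (\<lambda>_. x) P, {x, v})"
  define d where "d = (P, restrict (\<lambda>y. if y \<in> ?I then x else v) P, {x, v})"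
  have c: "c \<in> Hom ?C {x, v} P" and d: "d \<in> Hom ?C {x, v} P"
    using P by (auto simp: Hom_op_FinSet c_def d_def app_def)
  have eq: "a \<cdot>\<^bsub>?C\<^esub> d = a \<cdot>\<^bsub>?C\<^esub> c" "b \<cdot>\<^bsub>?C\<^esub> d = b \<cdot>\<^bsub>?C\<^esub> c"
    using a b by (auto simp: Comp_op_FinSet Hom_op_FinSet c_def d_def app_def
        intro!: restrict_ext simp: compose_def PiE_def Pi_def)
  have "f \<cdot>\<^bsub>?C\<^esub> (a \<cdot>\<^bsub>?C\<^esub> c) = g \<cdot>\<^bsub>?C\<^esub> (b \<cdot>\<^bsub>?C\<^esub> c)"
    using Comp_assoc[OF c a f] Comp_assoc[OF c b g] fg by simp
  moreover have "a \<cdot>\<^bsub>?C\<^esub> c \<in> Hom ?C {x, v} (Dom ?C f)" "b \<cdot>\<^bsub>?C\<^esub> c \<in> Hom ?C {x, v} (Dom ?C g)"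
    using a b c Comp_Hom by blast+
  moreover have "{x, v} \<in> Obj ?C"
    by (simp add: Obj_op_FinSet)
  ultimately have "\<exists>!h. h \<in> Hom ?C {x, v} P \<and> a \<cdot>\<^bsub>?C\<^esub> h = a \<cdot>\<^bsub>?C\<^esub> c \<and> b \<cdot>\<^bsub>?C\<^esub> h = b \<cdot>\<^bsub>?C\<^esub> c"
    using pb unfolding is_pullback_def by blast
  with c d eq have "c = d"
    by blast
  then have "app c x = app d x"
    by simp
  with \<open>x \<in> P\<close> \<open>v \<noteq> x\<close> show "x \<in> ?I"
    by (auto simp: c_def d_def app_def split: if_splits)
qed

text \<open>Together with \<open>proj_zer\<close> this makes the projection invertible. On
  underlying functions \<open>proj_zer\<close> gives injectivity of \<open>app (proj B)\<close>, so
  what remains is its surjectivity onto \<open>tot B\<close>.\<close>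

lemma additive_bundle_op_FinSet_trivial:
  fixes B :: "('u::infinite set, 'u set \<times> ('u \<Rightarrow> 'u) \<times> 'u set) add_bundle"
  assumes cat: "category (op_cat (FinSet :: ('u set, _) cat))"
    and bun: "additive_bundle (op_cat FinSet) B"
  shows "zer B \<cdot>\<^bsub>op_cat FinSet\<^esub> proj B = Ident (op_cat FinSet) (tot B)"
proof -
  let ?C = "op_cat (FinSet :: ('u set, _) cat)"
  interpret category ?C by fact
  interpret B: additive_bundle ?C B by fact
  obtain h k where
    h: "h \<in> Hom ?C (tot B) (sq B)" "sq0 B \<cdot>\<^bsub>?C\<^esub> h = zer B \<cdot>\<^bsub>?C\<^esub> proj B"
      "add B \<cdot>\<^bsub>?C\<^esub> h = Ident ?C (tot B)" and
    k: "k \<in> Hom ?C (tot B) (sq B)" "sq1 B \<cdot>\<^bsub>?C\<^esub> k = zer B \<cdot>\<^bsub>?C\<^esub> proj B"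
      "add B \<cdot>\<^bsub>?C\<^esub> k = Ident ?C (tot B)"
    using additive_bundle_units[OF cat bun] by metis
  have X: "tot B \<in> Obj ?C"
    using B.proj_Hom by (simp add: Hom_op_FinSet Obj_op_FinSet)
  have D: "Dom ?C (proj B) = tot B"
    using B.proj_Hom by (simp add: Hom_def)
  have a: "sq0 B \<in> Hom ?C (sq B) (tot B)" and b: "sq1 B \<in> Hom ?C (sq B) (tot B)"
    using B.sq_pullback D by (simp_all add: is_pullback_def)
  have fsts: "fst (sq0 B) = tot B" "fst (sq1 B) = tot B" "fst (zer B) = tot B"
    "fst (add B) = tot B" "fst (proj B) = base B"
    using a b B.zer_Hom B.add_Hom B.proj_Hom by (auto simp: Hom_op_FinSet)
  have z: "app (zer B) y \<in> base B" if "y \<in> tot B" for y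
    using B.zer_Hom that by (auto simp: Hom_op_FinSet)
  have pz: "app (zer B) (app (proj B) w) = w" if "w \<in> base B" for w
    using app_Comp_op_FinSet[of w "proj B" "zer B"] app_Ident_op_FinSet[OF that]
      B.proj_zer fsts that by simp
  have surj: "x \<in> app (proj B) ` base B" if x: "x \<in> tot B" for x
  proof -
    have "app (add B) x \<in> sq B"
      using B.add_Hom x by (auto simp: Hom_op_FinSet)
    then consider y where "y \<in> tot B" "app (add B) x = app (sq0 B) y"
      | y where "y \<in> tot B" "app (add B) x = app (sq1 B) y"
      using pushout_legs_jointly_surj[OF cat B.sq_pullback] fsts by auto
    \<comment> \<open>Apply \<open>app h\<close> if the sum lies in the copy \<open>sq0 B\<close>,
      and \<open>app k\<close> if it lies in \<open>sq1 B\<close>. The unit law returns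
      \<open>x\<close>, while the chosen map collapses that copy through the base.\<close>
    then obtain y where y: "y \<in> tot B" "x = app (zer B \<cdot>\<^bsub>?C\<^esub> proj B) y"
      using h k app_Comp_op_FinSet app_Ident_op_FinSet[OF x] fsts x by metis
    then show ?thesis
      using app_Comp_op_FinSet[of y "zer B" "proj B"] fsts z by auto
  qed
  show ?thesis
  proof (rule op_FinSet_arr_eqI)
    show "zer B \<cdot>\<^bsub>?C\<^esub> proj B \<in> Hom ?C (tot B) (tot B)"
      using B.proj_Hom B.zer_Hom Comp_Hom by blast
    show "Ident ?C (tot B) \<in> Hom ?C (tot B) (tot B)"
      using X by (rule Ident_Hom)
    fix x assume x: "x \<in> tot B"
    with surj obtain w where "w \<in> base B" "x = app (proj B) w"
      by blast
    with x show "app (zer B \<cdot>\<^bsub>?C\<^esub> proj B) x = app (Ident ?C (tot B)) x"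
      using pz fsts by (simp add: app_Comp_op_FinSet app_Ident_op_FinSet)
  qed
qed

text \<open>The components of \<open>tp S\<close> are invertible with inverse
  \<open>tzero S\<close>. The remaining compatibilities follow in any category from naturality of
  \<open>p\<close> and the bundle laws for lift and flip.\<close>

lemma (in tangent_category) tangent_iso_trivial:
  assumes zp: "\<And>M. M \<in> Obj C \<Longrightarrow> tzero S M \<cdot> tp S M = Ident C (TO S M)"
  shows "tangent_iso C S (trivial_tangent C) (tp S)"
proof -
  \<comment> \<open>These are the conditions of \<open>tangent_iso\<close> with the trivial
    structure unfolded.\<close>
  have "is_iso C (tp S M) \<and>
        Ident C M \<cdot> tp S M = tp S M \<and>
        tp S M \<cdot> tzero S M = Ident C M \<and>
        tp S M \<cdot> tplus S M = Ident C M \<cdot>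
          bpair C (tbundle (trivial_tangent C) M) (tp S M \<cdot> tpi0 S M) (tp S M \<cdot> tpi1 S M) \<and>
        (tp S M \<cdot> tp S (TO S M)) \<cdot> tlift S M = Ident C M \<cdot> tp S M \<and>
        (tp S M \<cdot> tp S (TO S M)) \<cdot> tflip S M = Ident C M \<cdot> (tp S M \<cdot> tp S (TO S M))"
    if M: "M \<in> Obj C" for M
  proof -
    interpret B: additive_bundle C "tbundle S M"
      using M by (rule T_bundle)
    have TM: "TO S M \<in> Obj C"
      using M T_functor by (simp add: endofunctor_def)
    have p: "tp S M \<in> Hom C (TO S M) M" and z: "tzero S M \<in> Hom C M (TO S M)"
      and plus: "tplus S M \<in> Hom C (tT2 S M) (TO S M)"
      and pz: "tp S M \<cdot> tzero S M = Ident C M"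
      and plus0: "tp S M \<cdot> tplus S M = tp S M \<cdot> tpi0 S M"
      and plus1: "tp S M \<cdot> tplus S M = tp S M \<cdot> tpi1 S M"
      using B.proj_Hom B.zer_Hom B.add_Hom B.proj_zer B.proj_add0 B.proj_add1
      by (simp_all add: tbundle_def)
    have pT: "tp S (TO S M) \<in> Hom C (TO S (TO S M)) (TO S M)"
      using p_natural TM by (simp add: nat_trans_def id_fun_def)
    have Tp: "TA S (tp S M) \<in> Hom C (TO S (TO S M)) (TO S M)"
      using T_functor p by (auto simp: endofunctor_def)
    \<comment> \<open>Naturality of \<open>p\<close> at the arrow \<open>tp S M\<close>.\<close>
    have nat: "tp S M \<cdot> tp S (TO S M) = tp S M \<cdot> TA S (tp S M)"
      using p_natural p unfolding nat_trans_def id_fun_def by auto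
    have l: "tlift S M \<in> Hom C (TO S M) (TO S (TO S M))"
      and pl: "TA S (tp S M) \<cdot> tlift S M = tzero S M \<cdot> tp S M"
      using lift_bundle[OF M] by (simp_all add: bundle_morphism_def tbundle_def map_bundle_def)
    have c: "tflip S M \<in> Hom C (TO S (TO S M)) (TO S (TO S M))"
      and pc: "tp S (TO S M) \<cdot> tflip S M = Ident C (TO S M) \<cdot> TA S (tp S M)"
      using flip_bundle[OF M] by (simp_all add: bundle_morphism_def tbundle_def map_bundle_def)
    have pplus: "tp S M \<cdot> tplus S M \<in> Hom C (tT2 S M) M"
      using plus p by (rule Comp_Hom)
    \<comment> \<open>Both projections of the trivial \<open>T\<^sub>2M\<close> are identities, and
      \<open>plus0\<close> and \<open>plus1\<close> make both components equal to the claimed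
      value.\<close>
    have "bpair C (tbundle (trivial_tangent C) M) (tp S M \<cdot> tpi0 S M) (tp S M \<cdot> tpi1 S M) =
        tp S M \<cdot> tplus S M"
      unfolding bpair_def pairing_def plus0[symmetric] plus1[symmetric]
    proof (rule the_equality)
      have "Dom C (tp S M \<cdot> tplus S M) = tT2 S M"
        using pplus by (simp add: Hom_def)
      then show "tp S M \<cdot> tplus S M \<in> Hom C (Dom C (tp S M \<cdot> tplus S M))
          (sq (tbundle (trivial_tangent C) M)) \<and>
        sq0 (tbundle (trivial_tangent C) M) \<cdot> tp S M \<cdot> tplus S M = tp S M \<cdot> tplus S M \<and>
        sq1 (tbundle (trivial_tangent C) M) \<cdot> tp S M \<cdot> tplus S M = tp S M \<cdot> tplus S M"
        using pplus Comp_Ident_left[OF pplus] by (simp add: tbundle_def trivial_tangent_def)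
    qed (auto simp: tbundle_def trivial_tangent_def Comp_Ident_left)
    then have add: "tp S M \<cdot> tplus S M = Ident C M \<cdot>
        bpair C (tbundle (trivial_tangent C) M) (tp S M \<cdot> tpi0 S M) (tp S M \<cdot> tpi1 S M)"
      using Comp_Ident_left[OF pplus] by simp
    \<comment> \<open>By \<open>nat\<close>, the inner \<open>tp S (TO S M)\<close> may be traded
      for \<open>TA S (tp S M)\<close>, which the lift sends to zero.\<close>
    have "(tp S M \<cdot> tp S (TO S M)) \<cdot> tlift S M = tp S M \<cdot> (tzero S M \<cdot> tp S M)"
      using Comp_assoc[OF l Tp p] nat pl by simp
    then have lift: "(tp S M \<cdot> tp S (TO S M)) \<cdot> tlift S M = Ident C M \<cdot> tp S M"
      using Comp_assoc[OF p z p] pz by simp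
    \<comment> \<open>The flip exchanges the two projections of the double tangent object, and
      \<open>nat\<close> identifies their composites with \<open>tp S M\<close>.\<close>
    have "(tp S M \<cdot> tp S (TO S M)) \<cdot> tflip S M = tp S M \<cdot> TA S (tp S M)"
      using Comp_assoc[OF c pT p] pc Comp_Ident_left[OF Tp] by simp
    then have flip: "(tp S M \<cdot> tp S (TO S M)) \<cdot> tflip S M =
        Ident C M \<cdot> (tp S M \<cdot> tp S (TO S M))"
      using Comp_Ident_left[OF Comp_Hom[OF pT p]] nat by simp
    have "is_iso C (tp S M)"
      using p z pz zp[OF M] by (auto simp: is_iso_def Hom_def)
    with Comp_Ident_left[OF p] pz add lift flip show ?thesis
      by blast
  qed
  then show ?thesis
    using p_natural by (simp add: tangent_iso_def trivial_tangent_def id_fun_def)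
qed

text \<open>The equality of structures is read up to natural isomorphism: transporting the trivial
  structure along any isomorphism of functors yields another tangent structure. The witness is
  \<open>tp S\<close>.\<close>

theorem proposition4p6:
  fixes S :: "('u::infinite set, 'u set \<times> ('u \<Rightarrow> 'u) \<times> 'u set) tangent"
  assumes "cartesian_tangent_category (op_cat FinSet) S"
  shows "\<exists>\<phi>. tangent_iso (op_cat FinSet) S (trivial_tangent (op_cat FinSet)) \<phi>"
proof
  interpret cartesian_tangent_category "op_cat FinSet" S by fact
  show "tangent_iso (op_cat FinSet) S (trivial_tangent (op_cat FinSet)) (tp S)"
  proof (rule tangent_iso_trivial)
    fix M :: "'u set" assume "M \<in> Obj (op_cat FinSet)"
    from additive_bundle_op_FinSet_trivial[OF category_axioms T_bundle[OF this]]
    show "tzero S M \<cdot>\<^bsub>op_cat FinSet\<^esub> tp S M = Ident (op_cat FinSet) (TO S M)"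
      by (simp add: tbundle_def)
  qed
qed

end
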